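(* Let $M=\mathrm{Span}\{e_{11}+e_{33},e_{12},e_{13},e_{22},e_{23}\}$. Let $M_3(\mathbb{C})=A\oplus B$ be a direct vector-space sum of two subalgebras with $\dim A=4$ and $\dim B=5$, where $B$ is the image of $M$ under some automorphism or antiautomorphism of $M_3(\mathbb{C})$. Then there is a map $\varphi\colon M_3(\mathbb{C})\to M_3(\mathbb{C})$, which is an automorphism or an antiautomorphism of $M_3(\mathbb{C})$, such that $\varphi(B)=M$ and $\varphi(A)=S$, where $S$ is one of the following subalgebras: (Z1) $\mathrm{Span}\{e_{11},e_{21},e_{31},e_{32}\}$; (Z2) $\mathrm{Span}\{e_{11},e_{21},e_{31},e_{32}+e_{33}\}$; (Z3) $\mathrm{Span}\{e_{11}+e_{22},e_{21},e_{31},e_{32}\}$; (Z4) $\mathrm{Span}\{e_{11}+e_{22},e_{21}+e_{12},e_{31},e_{32}\}$.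
   Context: $M_3(\mathbb{C})$ is the algebra of $3\times3$ complex matrices, $e_{ij}$ are the matrix units, and $\mathrm{Span}$ means linear span over $\mathbb{C}$. A subalgebra is a $\mathbb{C}$-linear subspace closed under multiplication; it is not required to contain the identity matrix. An automorphism is a $\mathbb{C}$-algebra automorphism of $M_3(\mathbb{C})$; an antiautomorphism is the composition of an automorphism and the transpose map. The phrase "up to transpose and up to action of $\mathrm{Aut}(M_3(\mathbb{C}))$" is expressed in the claim by the existence of $\varphi$. *)

theory Defs
  imports "HOL-Analysis.Analysis"
begin

type_synonym cmat3 = "complex^3^3"

text \<open>The library's scaling and \<open>span\<close> on \<open>complex^3^3\<close> are over the reals, and its
  \<open>vec.span\<close> covers only vectors over a field; hence a separate complex structure.\<close>

definition cscale :: "complex \<Rightarrow> cmat3 \<Rightarrow> cmat3"  (infixr "*\<^sub>C" 75) where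
  "c *\<^sub>C X = (\<chi> i j. c * X $ i $ j)"

interpretation cmat: vector_space cscale
  by unfold_locales (simp_all add: cscale_def vec_eq_iff algebra_simps)

text \<open>Not required to contain the identity matrix.\<close>

definition subalgebra :: "cmat3 set \<Rightarrow> bool" where
  "subalgebra A \<longleftrightarrow> cmat.subspace A \<and> (\<forall>X\<in>A. \<forall>Y\<in>A. X ** Y \<in> A)"

definition direct_sum_decomposition :: "cmat3 set \<Rightarrow> cmat3 set \<Rightarrow> bool" where
  "direct_sum_decomposition A B \<longleftrightarrow>
     {X + Y |X Y. X \<in> A \<and> Y \<in> B} = UNIV \<and> A \<inter> B = {0}"

text \<open>Preservation of the identity matrix follows from surjectivity and multiplicativity.\<close>

definition automorphism :: "(cmat3 \<Rightarrow> cmat3) \<Rightarrow> bool" where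
  "automorphism \<phi> \<longleftrightarrow> Vector_Spaces.linear cscale cscale \<phi> \<and> bij \<phi> \<and>
     (\<forall>X Y. \<phi> (X ** Y) = \<phi> X ** \<phi> Y)"

definition antiautomorphism :: "(cmat3 \<Rightarrow> cmat3) \<Rightarrow> bool" where
  "antiautomorphism \<phi> \<longleftrightarrow> (\<exists>\<psi>. automorphism \<psi> \<and> \<phi> = \<psi> \<circ> transpose)"

text \<open>In the index type \<open>3\<close> the numerals \<open>1, 2, 3\<close> are the three distinct elements
  (\<open>3\<close> coincides with \<open>0\<close>).\<close>

definition e :: "3 \<Rightarrow> 3 \<Rightarrow> cmat3" where
  "e i j = (\<chi> k l. if k = i \<and> l = j then 1 else 0)"

definition M :: "cmat3 set" where
  "M = cmat.span {e 1 1 + e 3 3, e 1 2, e 1 3, e 2 2, e 2 3}"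

definition Z1 :: "cmat3 set" where
  "Z1 = cmat.span {e 1 1, e 2 1, e 3 1, e 3 2}"

definition Z2 :: "cmat3 set" where
  "Z2 = cmat.span {e 1 1, e 2 1, e 3 1, e 3 2 + e 3 3}"

definition Z3 :: "cmat3 set" where
  "Z3 = cmat.span {e 1 1 + e 2 2, e 2 1, e 3 1, e 3 2}"

definition Z4 :: "cmat3 set" where
  "Z4 = cmat.span {e 1 1 + e 2 2, e 2 1 + e 1 2, e 3 1, e 3 2}"

end

theory Submission
  imports Defs
begin

text \<open>
  After applying an automorphism or antiautomorphism, \<open>B = M\<close>, and the task is to classify the
  subalgebras complementary to \<open>M\<close> up to the symmetries that preserve \<open>M\<close>: conjugation by
  invertible upper triangular matrices, and reflection in the antidiagonal (\<open>flip\<close>).  Since \<open>M\<close>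
  is cut out by \<open>x\<^sub>2\<^sub>1 = x\<^sub>3\<^sub>1 = x\<^sub>3\<^sub>2 = x\<^sub>3\<^sub>3 - x\<^sub>1\<^sub>1 = 0\<close>, a complement \<open>A\<close> is a subalgebra on
  which these four functionals are coordinates; in particular, as \<open>1 \<in> M\<close>, \<open>A\<close> contains no nonzero
  scalar matrix.

  \<^emph>\<open>An invariant plane.\<close>  Let \<open>v\<close> be the first basis vector.  The orbit \<open>A v\<close> maps onto
  \<open>\<complex>\<^sup>3 / \<langle>v\<rangle>\<close>.  If it is a plane, it is an invariant plane not containing \<open>v\<close>.  If it is all of
  \<open>\<complex>\<^sup>3\<close>, then \<open>{X \<in> A. X v = 0}\<close> is a one-dimensional left ideal, so the nonzero columns of its
  generator are common eigenvectors of \<open>A\<close>; as the generator has a nonzero coordinate, one of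
  these columns has a nonzero last entry, and a triangular conjugation moves it to the last basis
  vector.  Up to such a conjugation and a flip, \<open>A\<close> therefore preserves the plane of the last two
  basis vectors (\<open>exists_equivalent_preserving_plane\<close>).

  \<^emph>\<open>Removing the character.\<close>  Then \<open>X \<mapsto> x\<^sub>1\<^sub>1\<close> is multiplicative on \<open>A\<close>, and
  \<open>U = {X - x\<^sub>1\<^sub>1 1 | X \<in> A}\<close> is again a complement of \<open>M\<close>, because adding scalars does not change the
  coordinates (\<open>complement_zero_first_row\<close>).  All first rows in \<open>U\<close> vanish, which leaves so
  little room that the multiplication rules of the coordinate basis of \<open>U\<close> determine it up to
  two parameters (\<open>zero_first_row_cases\<close>).

  \<^emph>\<open>Restoring the character.\<close>  Conversely \<open>A = {X - \<mu>(X) 1 | X \<in> U}\<close> for a multiplicative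
  functional \<open>\<mu>\<close> on \<open>U\<close> (\<open>shift_multiplicative\<close>).  It vanishes on elements of square zero and is
  0 or 1 on idempotents, so there are few possibilities.  In each of them, up to conjugation, \<open>A\<close>
  or its flip contains either \<open>e\<^sub>1\<^sub>1\<close>, \<open>e\<^sub>2\<^sub>1\<close>, \<open>e\<^sub>3\<^sub>1\<close> together with a matrix of the lower right
  block, or \<open>e\<^sub>1\<^sub>1 + e\<^sub>2\<^sub>2\<close>, \<open>e\<^sub>3\<^sub>1\<close>, \<open>e\<^sub>3\<^sub>2\<close> together with a matrix of the upper left block.
  A triangular conjugation normalizes that one remaining matrix, and whether its trace,
  respectively its discriminant, vanishes decides between (Z1) and (Z2), respectively (Z3) and (Z4).
\<close>

section \<open>Matrix entries and subalgebras\<close>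

lemma mult_entry:
  "(X ** Y) $ i $ j = X$i$1 * Y$1$j + X$i$2 * Y$2$j + X$i$3 * Y$3$j" for X Y :: cmat3
  by (simp add: matrix_matrix_mult_def sum_3)

lemma mat3_eq_iff: "X = Y \<longleftrightarrow>
   X$1$1 = Y$1$1 \<and> X$1$2 = Y$1$2 \<and> X$1$3 = Y$1$3 \<and>
   X$2$1 = Y$2$1 \<and> X$2$2 = Y$2$2 \<and> X$2$3 = Y$2$3 \<and>
   X$3$1 = Y$3$1 \<and> X$3$2 = Y$3$2 \<and> X$3$3 = Y$3$3" for X Y :: cmat3
  by (auto simp: vec_eq_iff forall_3)

lemma cscale_entry: "(c *\<^sub>C X) $ i $ j = c * X $ i $ j"
  by (simp add: cscale_def)

lemmas entries = mult_entry cscale_entry e_def mat_def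

lemma mem_M: "X \<in> M \<longleftrightarrow> X$2$1 = 0 \<and> X$3$1 = 0 \<and> X$3$2 = 0 \<and> X$3$3 = X$1$1"
  by (auto simp: M_def cmat.span_breakdown_eq mat3_eq_iff cscale_def e_def)

lemma cmat_linear_iff: "Vector_Spaces.linear cscale cscale \<phi> \<longleftrightarrow>
    (\<forall>X Y. \<phi> (X + Y) = \<phi> X + \<phi> Y) \<and> (\<forall>c X. \<phi> (c *\<^sub>C X) = c *\<^sub>C \<phi> X)"
  by (simp add: Vector_Spaces.linear_iff cmat.vector_space_axioms)

lemma subalgebraD:
  assumes "subalgebra A"
  shows "0 \<in> A" and "X \<in> A \<Longrightarrow> Y \<in> A \<Longrightarrow> X + Y \<in> A" and "X \<in> A \<Longrightarrow> Y \<in> A \<Longrightarrow> X - Y \<in> A"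
    and "X \<in> A \<Longrightarrow> c *\<^sub>C X \<in> A" and "X \<in> A \<Longrightarrow> Y \<in> A \<Longrightarrow> X ** Y \<in> A"
  using assms unfolding subalgebra_def
  by (auto intro: cmat.subspace_0 cmat.subspace_add cmat.subspace_diff cmat.subspace_scale)

section \<open>Symmetries preserving M\<close>

lemma transpose_linear_bij:
  "transpose (X + Y) = transpose X + transpose Y"
  "transpose (c *\<^sub>C X) = c *\<^sub>C transpose X"
  "bij (transpose :: cmat3 \<Rightarrow> cmat3)"
  for X Y :: cmat3
proof -
  show "transpose (X + Y) = transpose X + transpose Y"
    and "transpose (c *\<^sub>C X) = c *\<^sub>C transpose X"
    by (simp_all add: vec_eq_iff transpose_def cscale_def)
  show "bij (transpose :: cmat3 \<Rightarrow> cmat3)"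
    by (rule o_bij[of transpose]) (auto simp: fun_eq_iff transpose_transpose)
qed

text \<open>This form treats automorphisms and antiautomorphisms alike, which makes closure under
  composition and inversion immediate.\<close>

lemma antiautomorphism_iff: "antiautomorphism \<phi> \<longleftrightarrow>
    Vector_Spaces.linear cscale cscale \<phi> \<and> bij \<phi> \<and> (\<forall>X Y. \<phi> (X ** Y) = \<phi> Y ** \<phi> X)"
proof
  assume "antiautomorphism \<phi>"
  then obtain \<psi> where "automorphism \<psi>" and "\<phi> = \<psi> \<circ> transpose"
    unfolding antiautomorphism_def by blast
  then show "Vector_Spaces.linear cscale cscale \<phi> \<and> bij \<phi> \<and>
      (\<forall>X Y. \<phi> (X ** Y) = \<phi> Y ** \<phi> X)"
    by (auto simp: automorphism_def cmat_linear_iff matrix_transpose_mul transpose_linear_bij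
        intro: bij_comp)
next
  assume "Vector_Spaces.linear cscale cscale \<phi> \<and> bij \<phi> \<and>
      (\<forall>X Y. \<phi> (X ** Y) = \<phi> Y ** \<phi> X)"
  then have "automorphism (\<phi> \<circ> transpose)"
    by (auto simp: automorphism_def cmat_linear_iff matrix_transpose_mul transpose_linear_bij
        intro: bij_comp)
  moreover have "\<phi> = (\<phi> \<circ> transpose) \<circ> transpose"
    by (simp add: fun_eq_iff transpose_transpose)
  ultimately show "antiautomorphism \<phi>"
    unfolding antiautomorphism_def by blast
qed

definition symmetry :: "(cmat3 \<Rightarrow> cmat3) \<Rightarrow> bool" where
  "symmetry \<phi> \<longleftrightarrow> automorphism \<phi> \<or> antiautomorphism \<phi>"

lemma symmetry_iff: "symmetry \<phi> \<longleftrightarrow>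
    Vector_Spaces.linear cscale cscale \<phi> \<and> bij \<phi> \<and>
    ((\<forall>X Y. \<phi> (X ** Y) = \<phi> X ** \<phi> Y) \<or> (\<forall>X Y. \<phi> (X ** Y) = \<phi> Y ** \<phi> X))"
  unfolding symmetry_def antiautomorphism_iff automorphism_def by blast

lemma symmetry_comp:
  assumes "symmetry \<phi>" and "symmetry \<psi>"
  shows "symmetry (\<phi> \<circ> \<psi>)"
  using assms unfolding symmetry_iff cmat_linear_iff by (auto intro: bij_comp)

lemma symmetry_inv:
  assumes "symmetry \<phi>"
  shows "symmetry (inv \<phi>)"
proof -
  have bij: "bij \<phi>" and lin: "\<phi> (X + Y) = \<phi> X + \<phi> Y" "\<phi> (c *\<^sub>C X) = c *\<^sub>C \<phi> X" for X Y c
    using assms by (simp_all add: symmetry_iff cmat_linear_iff)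
  have invI: "inv \<phi> X = Y" if "\<phi> Y = X" for X Y
    using bij that by (simp add: bij_is_inj inv_f_eq)
  have inv: "\<phi> (inv \<phi> X) = X" for X
    using bij by (simp add: bij_is_surj surj_f_inv_f)
  have "Vector_Spaces.linear cscale cscale (inv \<phi>)"
    unfolding cmat_linear_iff by (auto intro!: invI simp: lin inv)
  moreover have "(\<forall>X Y. inv \<phi> (X ** Y) = inv \<phi> X ** inv \<phi> Y) \<or>
      (\<forall>X Y. inv \<phi> (X ** Y) = inv \<phi> Y ** inv \<phi> X)"
  proof (cases "\<forall>X Y. \<phi> (X ** Y) = \<phi> X ** \<phi> Y")
    case True
    then show ?thesis
      by (intro disjI1 allI invI) (simp add: inv)
  next
    case False
    then have "\<forall>X Y. \<phi> (X ** Y) = \<phi> Y ** \<phi> X"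
      using assms unfolding symmetry_iff by blast
    then show ?thesis
      by (intro disjI2 allI invI) (simp add: inv)
  qed
  ultimately show ?thesis
    using bij_imp_bij_inv[OF bij] by (simp add: symmetry_iff)
qed

definition complement_of_M :: "cmat3 set \<Rightarrow> bool" where
  "complement_of_M A \<longleftrightarrow> subalgebra A \<and> direct_sum_decomposition A M"

lemma direct_sum_decomposition_image:
  assumes "symmetry \<phi>" and "direct_sum_decomposition A B"
  shows "direct_sum_decomposition (\<phi> ` A) (\<phi> ` B)"
proof -
  have add: "\<phi> (X + Y) = \<phi> X + \<phi> Y" and bij: "bij \<phi>" for X Y
    using assms(1) by (simp_all add: symmetry_iff cmat_linear_iff)
  have "\<phi> 0 = 0"
    using add[of 0 0] by simp
  moreover have "\<phi> ` A \<inter> \<phi> ` B = \<phi> ` (A \<inter> B)"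
    using bij by (simp add: bij_is_inj image_Int)
  moreover have "\<exists>X Y. Z = X + Y \<and> X \<in> \<phi> ` A \<and> Y \<in> \<phi> ` B" for Z
  proof -
    obtain W where W: "Z = \<phi> W"
      using bij by (metis bij_pointE)
    have "W \<in> {X + Y |X Y. X \<in> A \<and> Y \<in> B}"
      using assms(2) by (simp add: direct_sum_decomposition_def)
    then show ?thesis
      unfolding W using add by blast
  qed
  ultimately show ?thesis
    using assms(2) by (auto simp: direct_sum_decomposition_def)
qed

lemma subalgebra_image:
  assumes "symmetry \<phi>" and "subalgebra A"
  shows "subalgebra (\<phi> ` A)"
proof -
  have lin: "\<phi> (X + Y) = \<phi> X + \<phi> Y" "\<phi> (c *\<^sub>C X) = c *\<^sub>C \<phi> X" for X Y c
    using assms(1) by (simp_all add: symmetry_iff cmat_linear_iff)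
  have "\<phi> 0 = 0"
    using lin(1)[of 0 0] by simp
  then have "0 \<in> \<phi> ` A"
    using subalgebraD(1)[OF assms(2)] by (metis imageI)
  moreover have "X + Y \<in> \<phi> ` A" if "X \<in> \<phi> ` A" "Y \<in> \<phi> ` A" for X Y
    using that subalgebraD(2)[OF assms(2)] lin(1) by (metis (no_types, lifting) image_iff)
  moreover have "c *\<^sub>C X \<in> \<phi> ` A" if "X \<in> \<phi> ` A" for c X
    using that subalgebraD(4)[OF assms(2)] lin(2) by (metis (no_types, lifting) image_iff)
  ultimately have "cmat.subspace (\<phi> ` A)"
    unfolding cmat.subspace_def by blast
  moreover have "X ** Y \<in> \<phi> ` A" if XY: "X \<in> \<phi> ` A" "Y \<in> \<phi> ` A" for X Y
  proof -
    obtain X' Y' where "X' \<in> A" "Y' \<in> A" "X = \<phi> X'" "Y = \<phi> Y'"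
      using XY by blast
    moreover have "\<phi> (X' ** Y') = \<phi> X' ** \<phi> Y' \<or> \<phi> (Y' ** X') = \<phi> X' ** \<phi> Y'"
      using assms(1) unfolding symmetry_iff by blast
    ultimately show ?thesis
      using subalgebraD(5)[OF assms(2)] by (metis imageI)
  qed
  ultimately show ?thesis
    by (simp add: subalgebra_def)
qed

definition M_equivalent :: "cmat3 set \<Rightarrow> cmat3 set \<Rightarrow> bool" where
  "M_equivalent A B \<longleftrightarrow> (\<exists>\<phi>. symmetry \<phi> \<and> \<phi> ` M = M \<and> \<phi> ` A = B)"

lemma M_equivalent_trans:
  assumes "M_equivalent A B" and "M_equivalent B C"
  shows "M_equivalent A C"
proof -
  obtain \<phi> \<psi> where "symmetry \<phi>" "\<phi> ` M = M" "\<phi> ` A = B" "symmetry \<psi>" "\<psi> ` M = M" "\<psi> ` B = C"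
    using assms unfolding M_equivalent_def by blast
  then have "symmetry (\<psi> \<circ> \<phi>) \<and> (\<psi> \<circ> \<phi>) ` M = M \<and> (\<psi> \<circ> \<phi>) ` A = C"
    by (simp only: symmetry_comp image_comp[symmetric] simp_thms)
  then show ?thesis
    unfolding M_equivalent_def by blast
qed

lemma complement_of_M_equivalent:
  assumes "M_equivalent A B" and "complement_of_M A"
  shows "complement_of_M B"
  using assms unfolding M_equivalent_def complement_of_M_def
  by (metis direct_sum_decomposition_image subalgebra_image)

definition upper_triangular :: "cmat3 \<Rightarrow> bool" where
  "upper_triangular X \<longleftrightarrow> X$2$1 = 0 \<and> X$3$1 = 0 \<and> X$3$2 = 0"

text \<open>Such a conjugation preserves \<open>M\<close> because it keeps the diagonal entries of an upper triangular
  matrix, hence also the equation \<open>x\<^sub>1\<^sub>1 = x\<^sub>3\<^sub>3\<close>.  The image of \<open>A\<close> under \<open>X \<mapsto> g X h\<close> is written as a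
  preimage, so that membership of a matrix unit in it is a single product computation.\<close>

lemma M_equivalent_conjugate:
  assumes "upper_triangular g" and "upper_triangular h" and "h ** g = mat 1"
  shows "M_equivalent A {Z. h ** Z ** g \<in> A}"
proof -
  define \<phi> where "\<phi> = (\<lambda>X. g ** X ** h)"
  have gh: "g ** h = mat 1"
    using assms(3) matrix_left_right_inverse by blast
  have inv: "h ** (g ** X ** h) ** g = X" "g ** (h ** X ** g) ** h = X" for X
    by (metis assms(3) gh matrix_mul_assoc matrix_mul_lid matrix_mul_rid)+
  have img: "\<phi> ` S = {Z. h ** Z ** g \<in> S}" for S
    unfolding \<phi>_def using inv by (auto simp: image_iff) metis
  have "bij \<phi>"
    by (rule o_bij[of "\<lambda>X. h ** X ** g"]) (auto simp: \<phi>_def inv fun_eq_iff)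
  moreover have "Vector_Spaces.linear cscale cscale \<phi>"
    unfolding \<phi>_def cmat_linear_iff by (simp add: mat3_eq_iff entries algebra_simps)
  moreover have "\<phi> (X ** Y) = \<phi> X ** \<phi> Y" for X Y
    unfolding \<phi>_def by (metis assms(3) matrix_mul_assoc matrix_mul_rid)
  ultimately have "symmetry \<phi>"
    by (simp add: symmetry_iff)
  moreover have "\<phi> ` M = M"
  proof -
    have stable: "g' ** X ** h' \<in> M"
      if "upper_triangular g'" "upper_triangular h'" "h' ** g' = mat 1" "X \<in> M" for g' h' X
    proof -
      have "h'$1$1 * g'$1$1 = 1" "h'$3$3 * g'$3$3 = 1"
        using that(1-3) by (simp_all add: upper_triangular_def mat3_eq_iff entries)
      then show ?thesis
        using that(1,2,4) by (simp add: mem_M mult_entry upper_triangular_def algebra_simps)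
    qed
    show ?thesis
    proof (rule set_eqI)
      fix Z
      have "Z \<in> M" if "h ** Z ** g \<in> M"
        using stable[OF assms that] by (simp add: inv)
      moreover have "h ** Z ** g \<in> M" if "Z \<in> M"
        using stable[OF assms(2,1) gh that] .
      ultimately show "Z \<in> \<phi> ` M \<longleftrightarrow> Z \<in> M"
        unfolding img by blast
    qed
  qed
  ultimately show ?thesis
    unfolding M_equivalent_def using img by blast
qed

text \<open>Reflection in the antidiagonal: the antiautomorphism that reverses the flag preserved by
  upper triangular matrices.\<close>

definition flip :: "cmat3 \<Rightarrow> cmat3" where
  "flip X = (e 1 3 + e 2 2 + e 3 1) ** transpose X ** (e 1 3 + e 2 2 + e 3 1)"

lemma flip_entry [simp]:
  "flip X $ 1 $ 1 = X $ 3 $ 3" "flip X $ 1 $ 2 = X $ 2 $ 3" "flip X $ 1 $ 3 = X $ 1 $ 3"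
  "flip X $ 2 $ 1 = X $ 3 $ 2" "flip X $ 2 $ 2 = X $ 2 $ 2" "flip X $ 2 $ 3 = X $ 1 $ 2"
  "flip X $ 3 $ 1 = X $ 3 $ 1" "flip X $ 3 $ 2 = X $ 2 $ 1" "flip X $ 3 $ 3 = X $ 1 $ 1"
  by (simp_all add: flip_def entries transpose_def)

lemma M_equivalent_flip: "M_equivalent A {Z. flip Z \<in> A}"
proof -
  have flip2: "flip (flip X) = X" for X
    by (simp add: mat3_eq_iff)
  have img: "flip ` S = {Z. flip Z \<in> S}" for S
    using flip2 by (auto simp: image_iff) metis
  have "bij flip"
    by (rule o_bij[of flip]) (auto simp: flip2 fun_eq_iff)
  moreover have "Vector_Spaces.linear cscale cscale flip"
    unfolding cmat_linear_iff by (simp add: mat3_eq_iff cscale_entry)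
  moreover have "flip (X ** Y) = flip Y ** flip X" for X Y
    by (simp add: mat3_eq_iff mult_entry algebra_simps)
  ultimately have "symmetry flip"
    by (simp add: symmetry_iff)
  moreover have "flip ` M = M"
    unfolding img by (auto simp: mem_M)
  ultimately show ?thesis
    unfolding M_equivalent_def using img by blast
qed

section \<open>Coordinates on a complement of M\<close>

lemma complement_inter_M:
  assumes "complement_of_M A" and "X \<in> A" and "X \<in> M"
  shows "X = 0"
  using assms unfolding complement_of_M_def direct_sum_decomposition_def by blast

lemma complement_coordinates:
  assumes "complement_of_M A"
  obtains X where "X \<in> A" "X$2$1 = a" "X$3$1 = b" "X$3$2 = c" "X$3$3 - X$1$1 = d"
proof -
  define Z where "Z = a *\<^sub>C e 2 1 + b *\<^sub>C e 3 1 + c *\<^sub>C e 3 2 + d *\<^sub>C e 3 3"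
  have "Z \<in> {X + Y |X Y. X \<in> A \<and> Y \<in> M}"
    using assms by (simp add: complement_of_M_def direct_sum_decomposition_def)
  then obtain X Y where Z: "Z = X + Y" and "X \<in> A" "Y \<in> M"
    by blast
  then have "(Z - X)$2$1 = 0 \<and> (Z - X)$3$1 = 0 \<and> (Z - X)$3$2 = 0 \<and> (Z - X)$3$3 = (Z - X)$1$1"
    by (simp add: Z mem_M)
  then have "X$2$1 = a" "X$3$1 = b" "X$3$2 = c" "X$3$3 - X$1$1 = d"
    by (simp_all add: Z_def entries algebra_simps)
  with \<open>X \<in> A\<close> show ?thesis
    by (rule that)
qed

lemma complement_eqI:
  assumes "complement_of_M A" and "X \<in> A" and "Y \<in> A"
    and "X$2$1 = Y$2$1" "X$3$1 = Y$3$1" "X$3$2 = Y$3$2" "X$3$3 - X$1$1 = Y$3$3 - Y$1$1"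
  shows "X = Y"
proof -
  have "X - Y \<in> A"
    using assms(1-3) by (simp add: complement_of_M_def subalgebraD)
  moreover have "X - Y \<in> M"
    using assms(4-7) by (simp add: mem_M algebra_simps)
  ultimately have "X - Y = 0"
    by (rule complement_inter_M[OF assms(1)])
  then show ?thesis
    by simp
qed

text \<open>Two nested complements of \<open>M\<close> coincide, so four members of \<open>A\<close> that span modulo \<open>M\<close>
  span \<open>A\<close>.\<close>

lemma complement_eq_span:
  assumes "complement_of_M A" and "E1 \<in> A" "E2 \<in> A" "E3 \<in> A" "E4 \<in> A"
    and "\<And>X. \<exists>a b c d. X - (a *\<^sub>C E1 + b *\<^sub>C E2 + c *\<^sub>C E3 + d *\<^sub>C E4) \<in> M"
  shows "A = cmat.span {E1, E2, E3, E4}"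
proof
  have A: "subalgebra A"
    using assms(1) by (simp add: complement_of_M_def)
  show "cmat.span {E1, E2, E3, E4} \<subseteq> A"
    using assms(2-5) A by (intro cmat.span_minimal) (simp_all add: subalgebra_def)
  show "A \<subseteq> cmat.span {E1, E2, E3, E4}"
  proof
    fix X assume "X \<in> A"
    obtain a b c d where abcd: "X - (a *\<^sub>C E1 + b *\<^sub>C E2 + c *\<^sub>C E3 + d *\<^sub>C E4) \<in> M"
      using assms(6) by blast
    define Y where "Y = a *\<^sub>C E1 + b *\<^sub>C E2 + c *\<^sub>C E3 + d *\<^sub>C E4"
    have "Y \<in> A"
      unfolding Y_def using assms(2-5) by (simp add: subalgebraD[OF A])
    then have "X - Y = 0"
      using \<open>X \<in> A\<close> abcd by (intro complement_inter_M[OF assms(1)] subalgebraD(3)[OF A]) (simp_all add: Y_def)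
    moreover have "Y \<in> cmat.span {E1, E2, E3, E4}"
      unfolding Y_def by (intro cmat.span_add cmat.span_scale cmat.span_base) simp_all
    ultimately show "X \<in> cmat.span {E1, E2, E3, E4}"
      by simp
  qed
qed

section \<open>Multiplicative functionals\<close>

lemma scalar_in_complement:
  assumes "complement_of_M A" and "c *\<^sub>C mat 1 \<in> A"
  shows "c = 0"
proof -
  have "c *\<^sub>C mat 1 \<in> M"
    by (simp add: mem_M entries)
  then have "c *\<^sub>C mat 1 = (0 :: cmat3)"
    by (rule complement_inter_M[OF assms])
  then show ?thesis
    by (simp add: mat3_eq_iff entries)
qed

text \<open>Modulo scalar matrices, a matrix \<open>X\<close> has at most one representative \<open>X + a 1\<close> in \<open>A\<close>.  The
  assignment \<open>X \<mapsto> -a\<close> is multiplicative, since \<open>A\<close> is an ideal of \<open>A + \<complex> 1\<close> and \<open>-a\<close> is the class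
  of \<open>X\<close> in the quotient \<open>\<complex>\<close>.\<close>

lemma shift_multiplicative:
  assumes A: "complement_of_M A"
    and "X + a *\<^sub>C mat 1 \<in> A" "Y + b *\<^sub>C mat 1 \<in> A" "X ** Y + c *\<^sub>C mat 1 \<in> A"
  shows "c = - (a * b)"
proof -
  have "(X + a *\<^sub>C mat 1) ** (Y + b *\<^sub>C mat 1) - b *\<^sub>C (X + a *\<^sub>C mat 1)
      - a *\<^sub>C (Y + b *\<^sub>C mat 1) - (X ** Y + c *\<^sub>C mat 1) \<in> A" (is "?Z \<in> A")
    using assms by (simp add: complement_of_M_def subalgebraD)
  also have "?Z = (- (a * b) - c) *\<^sub>C mat 1"
    by (simp add: mat3_eq_iff entries algebra_simps)
  finally have "- (a * b) - c = 0"
    by (rule scalar_in_complement[OF A])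
  then show ?thesis
    by (metis eq_iff_diff_eq_0)
qed

lemma square_zero_in_complement:
  assumes A: "complement_of_M A" and "X + a *\<^sub>C mat 1 \<in> A" and "X ** X = 0"
  shows "X \<in> A"
proof -
  have "X ** X + 0 *\<^sub>C mat 1 \<in> A"
    using A by (simp add: assms(3) complement_of_M_def subalgebraD)
  then have "0 = - (a * a)"
    using shift_multiplicative[OF A assms(2,2)] by blast
  then show ?thesis
    using assms(2) by simp
qed

lemma idempotent_shift:
  assumes A: "complement_of_M A" and "X + a *\<^sub>C mat 1 \<in> A" and "X ** X = X"
  shows "a = 0 \<or> a = -1"
proof -
  have "a = - (a * a)"
    using shift_multiplicative[OF A assms(2,2)] assms(2,3) by simp
  then have "a * (a + 1) = 0"
    by (metis add.left_inverse distrib_left mult.right_neutral add.commute)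
  then show ?thesis
    by (simp add: eq_neg_iff_add_eq_0)
qed

section \<open>An invariant plane\<close>

text \<open>Invariance of the plane spanned by the last two basis vectors, for matrices acting on
  columns.\<close>

definition preserves_e2_e3_plane :: "cmat3 set \<Rightarrow> bool" where
  "preserves_e2_e3_plane A \<longleftrightarrow> (\<forall>X\<in>A. X$1$2 = 0 \<and> X$1$3 = 0)"

text \<open>\<open>P\<close> and \<open>Q\<close> below span the elements of \<open>A\<close> whose first column is a multiple of the first
  basis vector \<open>v\<close>.  Whether \<open>x\<^sub>1\<^sub>1\<close> vanishes on both decides whether \<open>A v\<close> is a plane or the
  whole space.\<close>

lemma exists_equivalent_preserving_plane:
  assumes A: "complement_of_M A"
  obtains B where "M_equivalent A B" and "preserves_e2_e3_plane B"
proof -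
  have sub: "subalgebra A"
    using A by (simp add: complement_of_M_def)
  note closed = subalgebraD[OF sub]
  obtain P where P: "P \<in> A" "P$2$1 = 0" "P$3$1 = 0" "P$3$2 = 1" "P$3$3 = P$1$1"
    by (rule complement_coordinates[OF A, of 0 0 1 0]) auto
  obtain Q where Q: "Q \<in> A" "Q$2$1 = 0" "Q$3$1 = 0" "Q$3$2 = 0" "Q$3$3 = 1 + Q$1$1"
    by (rule complement_coordinates[OF A, of 0 0 0 1]) (auto simp: algebra_simps)
  have first_column: "X = X$3$2 *\<^sub>C P + (X$3$3 - X$1$1) *\<^sub>C Q"
    if "X \<in> A" "X$2$1 = 0" "X$3$1 = 0" for X
    using that P Q by (intro complement_eqI[OF A]) (simp_all add: closed cscale_entry algebra_simps)
  show ?thesis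
  proof (cases "P$1$1 = 0 \<and> Q$1$1 = 0")
    case True
    obtain R where R: "R \<in> A" "R$2$1 = 1" "R$3$1 = 0"
      by (rule complement_coordinates[OF A, of 1 0 0 0]) auto
    obtain S where S: "S \<in> A" "S$2$1 = 0" "S$3$1 = 1"
      by (rule complement_coordinates[OF A, of 0 1 0 0]) auto
    define \<alpha> \<beta> where "\<alpha> = R$1$1" and "\<beta> = S$1$1"
    have corner: "X$1$1 = \<alpha> * X$2$1 + \<beta> * X$3$1" if "X \<in> A" for X
    proof -
      define Y where "Y = X - X$2$1 *\<^sub>C R - X$3$1 *\<^sub>C S"
      have "Y \<in> A" "Y$2$1 = 0" "Y$3$1 = 0"
        using that R S by (simp_all add: Y_def closed cscale_entry)
      from first_column[OF this] have "Y$1$1 = 0"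
        using True by (metis add.right_neutral cscale_entry mult_zero_right vector_add_component)
      then show ?thesis
        by (simp add: Y_def cscale_entry \<alpha>_def \<beta>_def algebra_simps)
    qed
    \<comment> \<open>The row \<open>(1, -\<alpha>, -\<beta>)\<close> is a left eigenvector of every \<open>X \<in> A\<close>: it annihilates \<open>A v\<close>, hence
      so does its product with \<open>X\<close>, and \<open>R v\<close>, \<open>S v\<close> span \<open>A v\<close>.\<close>
    have row: "X$1$2 - \<alpha> * X$2$2 - \<beta> * X$3$2 = - \<alpha> * (X$1$1 - \<alpha> * X$2$1 - \<beta> * X$3$1)"
      "X$1$3 - \<alpha> * X$2$3 - \<beta> * X$3$3 = - \<beta> * (X$1$1 - \<alpha> * X$2$1 - \<beta> * X$3$1)" if "X \<in> A" for X
      using corner[OF that] corner[OF closed(5)[OF that R(1)]] corner[OF closed(5)[OF that S(1)]]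
        R S by (simp_all add: mult_entry \<alpha>_def[symmetric] \<beta>_def[symmetric] algebra_simps)
    \<comment> \<open>Conjugation turns that row into \<open>(1, 0, 0)\<close>.\<close>
    define g h where "g = mat 1 - \<alpha> *\<^sub>C e 1 2 - \<beta> *\<^sub>C e 1 3"
      and "h = mat 1 + \<alpha> *\<^sub>C e 1 2 + \<beta> *\<^sub>C e 1 3"
    have "upper_triangular g" "upper_triangular h" "h ** g = mat 1"
      by (simp_all add: g_def h_def upper_triangular_def mat3_eq_iff entries)
    then have "M_equivalent A {Z. h ** Z ** g \<in> A}"
      by (rule M_equivalent_conjugate)
    moreover have "preserves_e2_e3_plane {Z. h ** Z ** g \<in> A}"
    proof -
      have "Z$1$2 = 0 \<and> Z$1$3 = 0" if "h ** Z ** g \<in> A" for Z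
        using row[OF that] by (simp add: g_def h_def entries algebra_simps)
      then show ?thesis
        by (simp add: preserves_e2_e3_plane_def)
    qed
    ultimately show ?thesis
      by (rule that)
  next
    case False
    \<comment> \<open>\<open>n\<close> spans the left ideal of the elements of \<open>A\<close> with zero first column.\<close>
    define n where "n = Q$1$1 *\<^sub>C P - P$1$1 *\<^sub>C Q"
    have n: "n \<in> A" "n$1$1 = 0" "n$2$1 = 0" "n$3$1 = 0" "n$3$2 = Q$1$1" "n$3$3 = - P$1$1"
      using P Q by (simp_all add: n_def closed cscale_entry algebra_simps)
    have multiple: "\<exists>c. X = c *\<^sub>C n" if X: "X \<in> A" "X$1$1 = 0" "X$2$1 = 0" "X$3$1 = 0" for X
    proof -
      have X': "X = X$3$2 *\<^sub>C P + X$3$3 *\<^sub>C Q"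
        using first_column[OF X(1,3,4)] X(2) by simp
      then have "X$1$1 = X$3$2 * P$1$1 + X$3$3 * Q$1$1"
        by (metis cscale_entry vector_add_component)
      then have rel: "X$3$2 * P$1$1 + X$3$3 * Q$1$1 = 0"
        using X(2) by simp
      define c where "c = (if Q$1$1 = 0 then - X$3$3 / P$1$1 else X$3$2 / Q$1$1)"
      have "X$3$2 = c * Q$1$1" "X$3$3 = - c * P$1$1"
        using rel False by (auto simp: c_def field_simps eq_neg_iff_add_eq_0 add.commute)
      then have "X = (c * Q$1$1) *\<^sub>C P + (- c * P$1$1) *\<^sub>C Q"
        using X' by simp
      also have "\<dots> = c *\<^sub>C n"
        by (simp add: n_def mat3_eq_iff cscale_entry algebra_simps)
      finally show ?thesis ..
    qed
    \<comment> \<open>Column \<open>j\<close> of \<open>n\<close>, scaled to \<open>(a, b, 1)\<close>, is a common eigenvector.\<close>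
    obtain j :: 3 where j: "n$3$j \<noteq> 0"
      using False n(5,6) by (metis neg_equal_0_iff_equal)
    define a b where "a = n$1$j / n$3$j" and "b = n$2$j / n$3$j"
    have eigen: "X$1$1 * a + X$1$2 * b + X$1$3 = a * (X$3$1 * a + X$3$2 * b + X$3$3)"
      "X$2$1 * a + X$2$2 * b + X$2$3 = b * (X$3$1 * a + X$3$2 * b + X$3$3)" if "X \<in> A" for X
    proof -
      have "X ** n \<in> A" "(X ** n)$1$1 = 0" "(X ** n)$2$1 = 0" "(X ** n)$3$1 = 0"
        using n that by (simp_all add: closed mult_entry)
      then obtain c where "X ** n = c *\<^sub>C n"
        using multiple by blast
      then have "(X ** n)$i$j = c * n$i$j" for i
        by (simp add: cscale_entry)
      from this[of 1] this[of 2] this[of 3]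
      have "X$1$1 * a + X$1$2 * b + X$1$3 = c * a" "X$2$1 * a + X$2$2 * b + X$2$3 = c * b"
        "X$3$1 * a + X$3$2 * b + X$3$3 = c"
        using j by (simp_all add: mult_entry a_def b_def field_simps)
      then show "X$1$1 * a + X$1$2 * b + X$1$3 = a * (X$3$1 * a + X$3$2 * b + X$3$3)"
        "X$2$1 * a + X$2$2 * b + X$2$3 = b * (X$3$1 * a + X$3$2 * b + X$3$3)"
        by simp_all
    qed
    \<comment> \<open>Conjugation moves the eigenvector to the third basis vector; the flip then turns the
      invariant line into an invariant plane.\<close>
    define g h where "g = mat 1 - a *\<^sub>C e 1 3 - b *\<^sub>C e 2 3"
      and "h = mat 1 + a *\<^sub>C e 1 3 + b *\<^sub>C e 2 3"
    have "upper_triangular g" "upper_triangular h" "h ** g = mat 1"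
      by (simp_all add: g_def h_def upper_triangular_def mat3_eq_iff entries)
    then have "M_equivalent A {Z. h ** Z ** g \<in> A}"
      by (rule M_equivalent_conjugate)
    moreover have "preserves_e2_e3_plane {Z. flip Z \<in> {Z. h ** Z ** g \<in> A}}"
    proof -
      have "Z$1$3 = 0 \<and> Z$2$3 = 0" if "h ** Z ** g \<in> A" for Z
        using eigen[OF that] by (simp add: g_def h_def entries algebra_simps)
      from this[of "flip Z" for Z] show ?thesis
        by (simp add: preserves_e2_e3_plane_def)
    qed
    ultimately show ?thesis
      using that[OF M_equivalent_trans[OF _ M_equivalent_flip]] by blast
  qed
qed

section \<open>Algebras with zero first row\<close>

text \<open>The coordinate basis \<open>G\<close>, \<open>H\<close>, \<open>E\<close>, \<open>F\<close> of \<open>U\<close> is known except for the entries in positions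
  \<open>(2,2)\<close> and \<open>(2,3)\<close>.  Those two entries of any member of \<open>U\<close> are given by its coordinates, and
  this rule applied to products of basis elements yields the constraints.  The two cases are named
  after the rank of the idempotent \<open>F\<close>.  In the second one, conjugation by \<open>1 + \<alpha> e\<^sub>2\<^sub>3\<close> would
  remove the parameter \<open>\<alpha>\<close>.\<close>

lemma zero_first_row_cases:
  assumes U: "complement_of_M U" and row: "\<And>X. X \<in> U \<Longrightarrow> X$1$1 = 0 \<and> X$1$2 = 0 \<and> X$1$3 = 0"
  obtains
    (rank_two) \<alpha> \<gamma> where "e 2 1 \<in> U" "e 3 1 \<in> U" "e 2 2 + e 3 3 \<in> U"
      "e 3 2 + \<alpha> *\<^sub>C e 2 2 + \<gamma> *\<^sub>C e 2 3 \<in> U"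
  | (rank_one) \<alpha> c where "e 3 3 + \<alpha> *\<^sub>C e 2 3 \<in> U" "e 3 2 + \<alpha> *\<^sub>C e 2 2 \<in> U"
      "e 3 1 + \<alpha> *\<^sub>C e 2 1 \<in> U" "e 2 1 + c *\<^sub>C (e 2 2 - \<alpha> *\<^sub>C e 2 3) \<in> U"
proof -
  have sub: "subalgebra U"
    using U by (simp add: complement_of_M_def)
  note closed = subalgebraD[OF sub]
  obtain G where G: "G \<in> U" "G$2$1 = 1" "G$3$1 = 0" "G$3$2 = 0" "G$3$3 = 0"
    by (rule complement_coordinates[OF U, of 1 0 0 0]) (auto simp: row)
  obtain H where H: "H \<in> U" "H$2$1 = 0" "H$3$1 = 1" "H$3$2 = 0" "H$3$3 = 0"
    by (rule complement_coordinates[OF U, of 0 1 0 0]) (auto simp: row)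
  obtain E where E: "E \<in> U" "E$2$1 = 0" "E$3$1 = 0" "E$3$2 = 1" "E$3$3 = 0"
    by (rule complement_coordinates[OF U, of 0 0 1 0]) (auto simp: row)
  obtain F where F: "F \<in> U" "F$2$1 = 0" "F$3$1 = 0" "F$3$2 = 0" "F$3$3 = 1"
    by (rule complement_coordinates[OF U, of 0 0 0 1]) (auto simp: row)
  note rows = row[OF G(1)] row[OF H(1)] row[OF E(1)] row[OF F(1)]
  note gens = G H E F rows
  have expand: "X = X$2$1 *\<^sub>C G + X$3$1 *\<^sub>C H + X$3$2 *\<^sub>C E + X$3$3 *\<^sub>C F" if "X \<in> U" for X
    using that gens row[OF that]
    by (intro complement_eqI[OF U]) (simp_all add: closed cscale_entry)
  have second_row:
    "X$2$2 = X$2$1 * G$2$2 + X$3$1 * H$2$2 + X$3$2 * E$2$2 + X$3$3 * F$2$2"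
    "X$2$3 = X$2$1 * G$2$3 + X$3$1 * H$2$3 + X$3$2 * E$2$3 + X$3$3 * F$2$3" if "X \<in> U" for X
    using arg_cong[OF expand[OF that], of "\<lambda>Y. Y$2$2"] arg_cong[OF expand[OF that], of "\<lambda>Y. Y$2$3"]
    by (simp_all add: cscale_entry)
  note prod = second_row[OF closed(5)]
  \<comment> \<open>\<open>F\<close> is idempotent, because \<open>F ** F\<close> has the same coordinates as \<open>F\<close>.\<close>
  have "F$2$2 * F$2$2 = F$2$2" and FF: "F$2$2 * F$2$3 = 0"
    using prod[OF F(1) F(1)] gens by (simp_all add: mult_entry)
  then consider "F$2$2 = 1" | "F$2$2 = 0"
    by (metis mult_cancel_left2)
  then show ?thesis
  proof cases
    case 1
    have F0: "F$2$3 = 0"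
      using 1 FF by simp
    have "G$2$2 = 0" "G$2$3 = 0"
      using prod[OF G(1) F(1)] by (simp_all add: mult_entry gens 1 F0)
    moreover have "H$2$2 = 0" "H$2$3 = 0"
      using prod[OF H(1) F(1)] by (simp_all add: mult_entry gens 1 F0)
    moreover note F0
    ultimately have "G = e 2 1" "H = e 3 1" "F = e 2 2 + e 3 3"
      "E = e 3 2 + E$2$2 *\<^sub>C e 2 2 + E$2$3 *\<^sub>C e 2 3"
      using 1 gens by (simp_all add: mat3_eq_iff entries)
    then show ?thesis
      using rank_two gens by metis
  next
    case 2
    define \<alpha> p where "\<alpha> = E$2$2" and "p = G$2$2"
    have FE: "F$2$3 = \<alpha>" "E$2$3 = 0"
      using prod[OF F(1) E(1)] by (simp_all add: mult_entry gens 2 \<alpha>_def)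
    have "G$2$2 * \<alpha> + G$2$3 = 0" "H$2$2 * \<alpha> + H$2$3 = 0"
      using prod[OF G(1) F(1)] prod[OF H(1) F(1)] by (simp_all add: mult_entry gens 2 FE)
    then have GF: "G$2$3 = - \<alpha> * p" "H$2$3 = - \<alpha> * H$2$2"
      unfolding p_def by algebra+
    have "E$2$2 * G$2$2 = E$2$2 * G$2$2 + H$2$2 + G$2$2 * E$2$2"
      using prod(1)[OF E(1) G(1)] by (simp add: mult_entry gens 2)
    then have "H$2$2 = - \<alpha> * p"
      unfolding \<alpha>_def p_def by algebra
    with FE GF have "F = e 3 3 + \<alpha> *\<^sub>C e 2 3" "E = e 3 2 + \<alpha> *\<^sub>C e 2 2"
      "H + \<alpha> *\<^sub>C G = e 3 1 + \<alpha> *\<^sub>C e 2 1" "G = e 2 1 + p *\<^sub>C (e 2 2 - \<alpha> *\<^sub>C e 2 3)"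
      using 2 gens by (simp_all add: mat3_eq_iff entries \<alpha>_def[symmetric] p_def[symmetric])
    then show ?thesis
      using rank_one[of \<alpha> p] gens closed by metis
  qed
qed

section \<open>Removing the character\<close>

text \<open>\<open>U\<close> is the kernel of the character \<open>X \<mapsto> x\<^sub>1\<^sub>1\<close> on the unital algebra \<open>A + \<complex> 1\<close>.\<close>

lemma complement_zero_first_row:
  assumes A: "complement_of_M A" and plane: "preserves_e2_e3_plane A"
  defines "U \<equiv> {Y. Y$1$1 = 0 \<and> (\<exists>a. Y + a *\<^sub>C mat 1 \<in> A)}"
  shows "complement_of_M U" and "X \<in> U \<Longrightarrow> X$1$1 = 0 \<and> X$1$2 = 0 \<and> X$1$3 = 0"
proof -
  have sub: "subalgebra A"
    using A by (simp add: complement_of_M_def)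
  note closed = subalgebraD[OF sub]
  have UI: "Y \<in> U" if "Y + a *\<^sub>C mat 1 \<in> A" "Y$1$1 = 0" for Y a
    using that by (auto simp: U_def)
  have row: "X$1$1 = 0 \<and> X$1$2 = 0 \<and> X$1$3 = 0" if X: "X \<in> U" for X
  proof -
    obtain a where "X$1$1 = 0" "X + a *\<^sub>C mat 1 \<in> A"
      using X by (auto simp: U_def)
    then show ?thesis
      using plane by (auto simp: preserves_e2_e3_plane_def entries)
  qed
  then show "X \<in> U \<Longrightarrow> X$1$1 = 0 \<and> X$1$2 = 0 \<and> X$1$3 = 0" .
  have "0 + 0 *\<^sub>C mat 1 \<in> A"
    using closed(1) by simp
  then have "0 \<in> U"
    by (rule UI) simp
  moreover have "X + Y \<in> U" "X ** Y \<in> U" if XY: "X \<in> U" "Y \<in> U" for X Y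
  proof -
    obtain a b where ab: "X + a *\<^sub>C mat 1 \<in> A" "Y + b *\<^sub>C mat 1 \<in> A"
      using XY by (auto simp: U_def)
    have "(X + Y) + (a + b) *\<^sub>C mat 1 \<in> A"
      using closed(2)[OF ab] by (simp add: cmat.scale_left_distrib algebra_simps)
    then show "X + Y \<in> U"
      by (rule UI) (simp add: row[OF XY(1)] row[OF XY(2)])
    have "(X + a *\<^sub>C mat 1) ** (Y + b *\<^sub>C mat 1) - b *\<^sub>C (X + a *\<^sub>C mat 1)
        - a *\<^sub>C (Y + b *\<^sub>C mat 1) \<in> A" (is "?Z \<in> A")
      using ab by (simp add: closed)
    also have "?Z = X ** Y + (- (a * b)) *\<^sub>C mat 1"
      by (simp add: mat3_eq_iff entries algebra_simps)
    finally show "X ** Y \<in> U"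
      by (rule UI) (simp add: row[OF XY(1)] mult_entry)
  qed
  moreover have "c *\<^sub>C X \<in> U" if X: "X \<in> U" for c X
  proof -
    obtain a where a: "X + a *\<^sub>C mat 1 \<in> A"
      using X by (auto simp: U_def)
    have "c *\<^sub>C X + (c * a) *\<^sub>C mat 1 \<in> A"
      using closed(4)[OF a, of c] by (simp add: cmat.scale_right_distrib)
    then show ?thesis
      by (rule UI) (simp add: row[OF X] cscale_entry)
  qed
  ultimately have "subalgebra U"
    unfolding subalgebra_def cmat.subspace_def by blast
  moreover have "\<exists>X Y. Z = X + Y \<and> X \<in> U \<and> Y \<in> M" for Z
  proof -
    have "Z \<in> {X + Y |X Y. X \<in> A \<and> Y \<in> M}"
      using A by (simp add: complement_of_M_def direct_sum_decomposition_def)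
    then obtain X Y where XY: "Z = X + Y" "X \<in> A" "Y \<in> M"
      by blast
    define a where "a = X$1$1"
    have "X - a *\<^sub>C mat 1 \<in> U"
      using XY(2) by (intro UI[of _ a]) (simp_all add: a_def entries)
    moreover have "Y + a *\<^sub>C mat 1 \<in> M"
      using XY(3) by (simp add: mem_M entries)
    moreover have "Z = (X - a *\<^sub>C mat 1) + (Y + a *\<^sub>C mat 1)"
      by (simp add: XY(1))
    ultimately show ?thesis
      by blast
  qed
  moreover have "X = 0" if X: "X \<in> U" "X \<in> M" for X
  proof -
    obtain a where a: "X + a *\<^sub>C mat 1 \<in> A"
      using X(1) by (auto simp: U_def)
    have "X + a *\<^sub>C mat 1 \<in> M"
      using X(2) by (simp add: mem_M entries)
    from complement_inter_M[OF A a this] have X_eq: "X = (- a) *\<^sub>C mat 1"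
      by (simp add: eq_neg_iff_add_eq_0)
    then have "X$1$1 = - a"
      by (simp add: entries)
    then show ?thesis
      using X_eq row[OF X(1)] by simp
  qed
  moreover have "0 \<in> M"
    by (simp add: mem_M)
  ultimately show "complement_of_M U"
    unfolding complement_of_M_def direct_sum_decomposition_def using \<open>0 \<in> U\<close> by blast
qed

section \<open>Normal forms\<close>

text \<open>By Cayley--Hamilton for the block of the fourth generator \<open>x\<close>, \<open>x\<^sup>2 - (a + d) x\<close> is
  \<open>b - a d\<close> times \<open>e\<^sub>2\<^sub>2 + e\<^sub>3\<^sub>3\<close>.  Completed by a multiple of \<open>e\<^sub>1\<^sub>1\<close> it is a scalar matrix in \<open>A\<close>,
  so \<open>b = a d\<close> and the block is the product of the column \<open>(a, 1)\<close> and the row \<open>(1, d)\<close>.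
  Conjugation moves the column to \<open>(0, 1)\<close>, which changes the row to \<open>(1, a + d)\<close>, and a
  diagonal scaling makes both entries of this row equal unless \<open>a + d\<close> is 0.\<close>

lemma equivalent_Z1_or_Z2:
  assumes A: "complement_of_M A" and gens: "e 1 1 \<in> A" "e 2 1 \<in> A" "e 3 1 \<in> A"
    and x: "e 3 2 + a *\<^sub>C e 2 2 + b *\<^sub>C e 2 3 + d *\<^sub>C e 3 3 \<in> A" (is "?x \<in> A")
  shows "M_equivalent A Z1 \<or> M_equivalent A Z2"
proof -
  have sub: "subalgebra A"
    using A by (simp add: complement_of_M_def)
  note closed = subalgebraD[OF sub]
  have "?x ** ?x - (a + d) *\<^sub>C ?x + (b - a * d) *\<^sub>C e 1 1 \<in> A" (is "?y \<in> A")
    using gens x by (simp add: closed)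
  also have "?y = (b - a * d) *\<^sub>C mat 1"
    by (simp add: mat3_eq_iff entries algebra_simps)
  finally have b: "b = a * d"
    using scalar_in_complement[OF A] by (metis eq_iff_diff_eq_0)
  show ?thesis
  proof (cases "a + d = 0")
    case True
    then have d: "d = - a"
      by (simp add: eq_neg_iff_add_eq_0 add.commute)
    define g h where "g = mat 1 - a *\<^sub>C e 2 3" and "h = mat 1 + a *\<^sub>C e 2 3"
    define B where "B = {Z. h ** Z ** g \<in> A}"
    have AB: "M_equivalent A B"
      unfolding B_def by (rule M_equivalent_conjugate)
        (simp_all add: g_def h_def upper_triangular_def mat3_eq_iff entries)
    then have compl: "complement_of_M B"
      using A by (rule complement_of_M_equivalent)
    have eqs: "h ** e 1 1 ** g = e 1 1" "h ** e 2 1 ** g = e 2 1"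
        "h ** e 3 1 ** g = e 3 1 + a *\<^sub>C e 2 1" "h ** e 3 2 ** g = ?x"
      by (simp_all add: g_def h_def b d mat3_eq_iff entries)
    have "e 1 1 \<in> B" "e 2 1 \<in> B" "e 3 1 \<in> B" "e 3 2 \<in> B"
      unfolding B_def mem_Collect_eq eqs using gens x by (simp_all only: closed)
    then have "B = cmat.span {e 1 1, e 2 1, e 3 1, e 3 2}"
    proof (rule complement_eq_span[OF compl])
      fix X :: cmat3
      have "X - ((X$1$1 - X$3$3) *\<^sub>C e 1 1 + X$2$1 *\<^sub>C e 2 1 + X$3$1 *\<^sub>C e 3 1 + X$3$2 *\<^sub>C e 3 2) \<in> M"
        by (simp add: mem_M entries)
      then show "\<exists>a b c d. X - (a *\<^sub>C e 1 1 + b *\<^sub>C e 2 1 + c *\<^sub>C e 3 1 + d *\<^sub>C e 3 2) \<in> M"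
        by blast
    qed
    then show ?thesis
      using AB by (simp add: Z1_def)
  next
    case False
    define k where "k = a + d"
    have k: "k \<noteq> 0" "d = k - a"
      using False by (simp_all add: k_def)
    define g h where "g = e 1 1 + (1 / k) *\<^sub>C e 2 2 - (a / k) *\<^sub>C e 2 3 + e 3 3"
      and "h = e 1 1 + k *\<^sub>C e 2 2 + a *\<^sub>C e 2 3 + e 3 3"
    define B where "B = {Z. h ** Z ** g \<in> A}"
    have AB: "M_equivalent A B"
      unfolding B_def by (rule M_equivalent_conjugate)
        (simp_all add: g_def h_def k(1) upper_triangular_def mat3_eq_iff entries)
    then have compl: "complement_of_M B"
      using A by (rule complement_of_M_equivalent)
    have eqs: "h ** e 1 1 ** g = e 1 1" "h ** e 2 1 ** g = k *\<^sub>C e 2 1"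
        "h ** e 3 1 ** g = e 3 1 + a *\<^sub>C e 2 1" "h ** (e 3 2 + e 3 3) ** g = (1 / k) *\<^sub>C ?x"
      using k(1) by (simp_all add: g_def h_def b k(2) mat3_eq_iff entries field_simps)
    have "e 1 1 \<in> B" "e 2 1 \<in> B" "e 3 1 \<in> B" "e 3 2 + e 3 3 \<in> B"
      unfolding B_def mem_Collect_eq eqs using gens x by (simp_all only: closed)
    then have "B = cmat.span {e 1 1, e 2 1, e 3 1, e 3 2 + e 3 3}"
    proof (rule complement_eq_span[OF compl])
      fix X :: cmat3
      have "X - ((X$1$1 - X$3$3 + X$3$2) *\<^sub>C e 1 1 + X$2$1 *\<^sub>C e 2 1 + X$3$1 *\<^sub>C e 3 1
          + X$3$2 *\<^sub>C (e 3 2 + e 3 3)) \<in> M"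
        by (simp add: mem_M entries)
      then show "\<exists>a b c d. X - (a *\<^sub>C e 1 1 + b *\<^sub>C e 2 1 + c *\<^sub>C e 3 1
          + d *\<^sub>C (e 3 2 + e 3 3)) \<in> M"
        by blast
    qed
    then show ?thesis
      using AB by (simp add: Z2_def)
  qed
qed

text \<open>Modulo \<open>e\<^sub>1\<^sub>1 + e\<^sub>2\<^sub>2\<close> the block of the fourth generator may be taken to have trace zero.
  Conjugation by \<open>1 + t e\<^sub>1\<^sub>2\<close> with \<open>t = -d/2\<close> then clears its diagonal and turns it into
  \<open>e\<^sub>2\<^sub>1 + (b + t\<^sup>2) e\<^sub>1\<^sub>2\<close>; a nonzero \<open>b + t\<^sup>2\<close> becomes 1 by a diagonal scaling with a square root of
  it.\<close>

lemma equivalent_Z3_or_Z4: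
  assumes A: "complement_of_M A" and gens: "e 1 1 + e 2 2 \<in> A" "e 3 1 \<in> A" "e 3 2 \<in> A"
    and x: "e 2 1 + b *\<^sub>C e 1 2 + d *\<^sub>C e 2 2 \<in> A" (is "?x \<in> A")
  shows "M_equivalent A Z3 \<or> M_equivalent A Z4"
proof -
  have sub: "subalgebra A"
    using A by (simp add: complement_of_M_def)
  note closed = subalgebraD[OF sub]
  define t where "t = - d / 2"
  have d: "d = - 2 * t"
    by (simp add: t_def)
  show ?thesis
  proof (cases "b + t\<^sup>2 = 0")
    case True
    then have b: "b = - t\<^sup>2"
      by (simp add: eq_neg_iff_add_eq_0)
    define g h where "g = mat 1 - t *\<^sub>C e 1 2" and "h = mat 1 + t *\<^sub>C e 1 2"
    define B where "B = {Z. h ** Z ** g \<in> A}"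
    have AB: "M_equivalent A B"
      unfolding B_def by (rule M_equivalent_conjugate)
        (simp_all add: g_def h_def upper_triangular_def mat3_eq_iff entries)
    then have compl: "complement_of_M B"
      using A by (rule complement_of_M_equivalent)
    have eqs: "h ** (e 1 1 + e 2 2) ** g = e 1 1 + e 2 2"
        "h ** e 2 1 ** g = ?x + t *\<^sub>C (e 1 1 + e 2 2)"
        "h ** e 3 1 ** g = e 3 1 - t *\<^sub>C e 3 2" "h ** e 3 2 ** g = e 3 2"
      by (simp_all add: g_def h_def b d mat3_eq_iff entries power2_eq_square)
    have "e 1 1 + e 2 2 \<in> B" "e 2 1 \<in> B" "e 3 1 \<in> B" "e 3 2 \<in> B"
      unfolding B_def mem_Collect_eq eqs using gens x by (simp_all only: closed)
    then have "B = cmat.span {e 1 1 + e 2 2, e 2 1, e 3 1, e 3 2}"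
    proof (rule complement_eq_span[OF compl])
      fix X :: cmat3
      have "X - ((X$1$1 - X$3$3) *\<^sub>C (e 1 1 + e 2 2) + X$2$1 *\<^sub>C e 2 1 + X$3$1 *\<^sub>C e 3 1
          + X$3$2 *\<^sub>C e 3 2) \<in> M"
        by (simp add: mem_M entries)
      then show "\<exists>a b c d. X - (a *\<^sub>C (e 1 1 + e 2 2) + b *\<^sub>C e 2 1 + c *\<^sub>C e 3 1
          + d *\<^sub>C e 3 2) \<in> M"
        by blast
    qed
    then show ?thesis
      using AB by (simp add: Z3_def)
  next
    case False
    define p where "p = csqrt (b + t\<^sup>2)"
    have p: "p \<noteq> 0" and "p\<^sup>2 = b + t\<^sup>2"
      using False by (simp_all add: p_def)
    then have b: "b = p * p - t * t"
      by (simp add: power2_eq_square)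
    define g h where "g = (1 / p) *\<^sub>C e 1 1 - (t / p) *\<^sub>C e 1 2 + e 2 2 + e 3 3"
      and "h = p *\<^sub>C e 1 1 + t *\<^sub>C e 1 2 + e 2 2 + e 3 3"
    define B where "B = {Z. h ** Z ** g \<in> A}"
    have AB: "M_equivalent A B"
      unfolding B_def by (rule M_equivalent_conjugate)
        (simp_all add: g_def h_def p upper_triangular_def mat3_eq_iff entries)
    then have compl: "complement_of_M B"
      using A by (rule complement_of_M_equivalent)
    have eqs: "h ** (e 1 1 + e 2 2) ** g = e 1 1 + e 2 2"
        "h ** (e 2 1 + e 1 2) ** g = (1 / p) *\<^sub>C (?x + t *\<^sub>C (e 1 1 + e 2 2))"
        "h ** e 3 1 ** g = (1 / p) *\<^sub>C (e 3 1 - t *\<^sub>C e 3 2)" "h ** e 3 2 ** g = e 3 2"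
      using p by (simp_all add: g_def h_def b d mat3_eq_iff entries field_simps)
    have "e 1 1 + e 2 2 \<in> B" "e 2 1 + e 1 2 \<in> B" "e 3 1 \<in> B" "e 3 2 \<in> B"
      unfolding B_def mem_Collect_eq eqs using gens x by (simp_all only: closed)
    then have "B = cmat.span {e 1 1 + e 2 2, e 2 1 + e 1 2, e 3 1, e 3 2}"
    proof (rule complement_eq_span[OF compl])
      fix X :: cmat3
      have "X - ((X$1$1 - X$3$3) *\<^sub>C (e 1 1 + e 2 2) + X$2$1 *\<^sub>C (e 2 1 + e 1 2)
          + X$3$1 *\<^sub>C e 3 1 + X$3$2 *\<^sub>C e 3 2) \<in> M"
        by (simp add: mem_M entries)
      then show "\<exists>a b c d. X - (a *\<^sub>C (e 1 1 + e 2 2) + b *\<^sub>C (e 2 1 + e 1 2) + c *\<^sub>C e 3 1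
          + d *\<^sub>C e 3 2) \<in> M"
        by blast
    qed
    then show ?thesis
      using AB by (simp add: Z4_def)
  qed
qed

section \<open>Classification\<close>

text \<open>The shifts \<open>a\<close>, \<open>b\<close> are minus the values of the multiplicative functional.  Where it is 0 on
  the idempotent \<open>e\<^sub>2\<^sub>2 + e\<^sub>3\<^sub>3\<close>, it is 0 on the last generator too, which is its own product
  with that idempotent; where it is 1, \<open>A\<close> contains \<open>1 - (e\<^sub>2\<^sub>2 + e\<^sub>3\<^sub>3) = e\<^sub>1\<^sub>1\<close>.\<close>

lemma complement_classification_rank_two:
  assumes A: "complement_of_M A"
    and gens: "e 2 1 \<in> A" "e 3 1 \<in> A"
    and p: "(e 2 2 + e 3 3) + a *\<^sub>C mat 1 \<in> A"
    and q: "(e 3 2 + \<alpha> *\<^sub>C e 2 2 + \<gamma> *\<^sub>C e 2 3) + b *\<^sub>C mat 1 \<in> A"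
  obtains Z where "Z \<in> {Z1, Z2, Z3, Z4}" "M_equivalent A Z"
proof -
  have sub: "subalgebra A"
    using A by (simp add: complement_of_M_def)
  note closed = subalgebraD[OF sub]
  have idem: "a = 0 \<or> a = -1"
    by (rule idempotent_shift[OF A p]) (simp add: mat3_eq_iff entries)
  have "(e 2 2 + e 3 3) ** (e 3 2 + \<alpha> *\<^sub>C e 2 2 + \<gamma> *\<^sub>C e 2 3) = e 3 2 + \<alpha> *\<^sub>C e 2 2 + \<gamma> *\<^sub>C e 2 3"
    by (simp add: mat3_eq_iff entries)
  then have ab: "b = - (a * b)"
    using shift_multiplicative[OF A p q] q by simp
  from idem show ?thesis
  proof
    assume a: "a = 0"
    define B where "B = {Z. flip Z \<in> A}"
    have AB: "M_equivalent A B"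
      unfolding B_def by (rule M_equivalent_flip)
    then have B: "complement_of_M B"
      using A by (rule complement_of_M_equivalent)
    have flips: "flip (e 1 1 + e 2 2) = e 2 2 + e 3 3" "flip (e 3 1) = e 3 1" "flip (e 3 2) = e 2 1"
      "flip (e 2 1 + \<gamma> *\<^sub>C e 1 2 + \<alpha> *\<^sub>C e 2 2) = e 3 2 + \<alpha> *\<^sub>C e 2 2 + \<gamma> *\<^sub>C e 2 3"
      by (simp_all add: mat3_eq_iff entries)
    have "e 1 1 + e 2 2 \<in> B" "e 3 1 \<in> B" "e 3 2 \<in> B" "e 2 1 + \<gamma> *\<^sub>C e 1 2 + \<alpha> *\<^sub>C e 2 2 \<in> B"
      unfolding B_def mem_Collect_eq flips using gens p q a ab by simp_all
    from equivalent_Z3_or_Z4[OF B this] show ?thesis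
      using that M_equivalent_trans[OF AB] by blast
  next
    assume a: "a = -1"
    have "(-1) *\<^sub>C ((e 2 2 + e 3 3) + a *\<^sub>C mat 1) \<in> A"
      using p by (rule closed)
    also have "(-1) *\<^sub>C ((e 2 2 + e 3 3) + a *\<^sub>C mat 1) = e 1 1"
      by (simp add: a mat3_eq_iff entries)
    finally have e11: "e 1 1 \<in> A" .
    have "(e 3 2 + \<alpha> *\<^sub>C e 2 2 + \<gamma> *\<^sub>C e 2 3) + b *\<^sub>C mat 1 - b *\<^sub>C e 1 1 \<in> A" (is "?y \<in> A")
      using q e11 by (simp add: closed)
    also have "?y = e 3 2 + (\<alpha> + b) *\<^sub>C e 2 2 + \<gamma> *\<^sub>C e 2 3 + b *\<^sub>C e 3 3"
      by (simp add: mat3_eq_iff entries)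
    finally show ?thesis
      using equivalent_Z1_or_Z2[OF A e11 gens] that by blast
  qed
qed

text \<open>The same argument for the idempotent \<open>e\<^sub>3\<^sub>3\<close>, which now annihilates the last generator, so the
  functional cannot be nonzero on both.\<close>

lemma complement_classification_rank_one:
  assumes A: "complement_of_M A"
    and gens: "e 3 1 \<in> A" "e 3 2 \<in> A"
    and p: "e 3 3 + a *\<^sub>C mat 1 \<in> A"
    and w: "(e 2 1 + c *\<^sub>C e 2 2) + b *\<^sub>C mat 1 \<in> A"
  obtains Z where "Z \<in> {Z1, Z2, Z3, Z4}" "M_equivalent A Z"
proof -
  have sub: "subalgebra A"
    using A by (simp add: complement_of_M_def)
  note closed = subalgebraD[OF sub]
  have idem: "a = 0 \<or> a = -1"
    by (rule idempotent_shift[OF A p]) (simp add: mat3_eq_iff entries)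
  have "e 3 3 ** (e 2 1 + c *\<^sub>C e 2 2) + 0 *\<^sub>C mat 1 = 0"
    by (simp add: mat3_eq_iff entries)
  then have ab: "0 = - (a * b)"
    using shift_multiplicative[OF A p w] closed(1) by metis
  from idem show ?thesis
  proof
    assume a: "a = 0"
    define B where "B = {Z. flip Z \<in> A}"
    have AB: "M_equivalent A B"
      unfolding B_def by (rule M_equivalent_flip)
    then have B: "complement_of_M B"
      using A by (rule complement_of_M_equivalent)
    have flips: "flip (e 1 1) = e 3 3" "flip (e 2 1) = e 3 2" "flip (e 3 1) = e 3 1"
      "flip (e 3 2 + (c + b) *\<^sub>C e 2 2 + 0 *\<^sub>C e 2 3 + b *\<^sub>C e 3 3)
        = (e 2 1 + c *\<^sub>C e 2 2) + b *\<^sub>C mat 1 - b *\<^sub>C e 3 3"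
      by (simp_all add: mat3_eq_iff entries)
    have e33: "e 3 3 \<in> A"
      using p a by simp
    have "e 1 1 \<in> B" "e 2 1 \<in> B" "e 3 1 \<in> B"
      "e 3 2 + (c + b) *\<^sub>C e 2 2 + 0 *\<^sub>C e 2 3 + b *\<^sub>C e 3 3 \<in> B"
      unfolding B_def mem_Collect_eq flips using gens e33 w by (simp_all only: closed)
    from equivalent_Z1_or_Z2[OF B this] show ?thesis
      using that M_equivalent_trans[OF AB] by blast
  next
    assume a: "a = -1"
    have "(-1) *\<^sub>C (e 3 3 + a *\<^sub>C mat 1) \<in> A"
      using p by (rule closed)
    also have "(-1) *\<^sub>C (e 3 3 + a *\<^sub>C mat 1) = e 1 1 + e 2 2"
      by (simp add: a mat3_eq_iff entries)
    finally have diag: "e 1 1 + e 2 2 \<in> A" .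
    have "e 2 1 + 0 *\<^sub>C e 1 2 + c *\<^sub>C e 2 2 \<in> A"
      using w ab a by simp
    from equivalent_Z3_or_Z4[OF A diag gens this] show ?thesis
      using that by blast
  qed
qed

lemma complement_classification:
  assumes A: "complement_of_M A"
  obtains Z where "Z \<in> {Z1, Z2, Z3, Z4}" "M_equivalent A Z"
proof -
  obtain B where AB: "M_equivalent A B" and plane: "preserves_e2_e3_plane B"
    by (rule exists_equivalent_preserving_plane[OF A])
  have B: "complement_of_M B"
    using AB A by (rule complement_of_M_equivalent)
  define U where "U = {Y. Y$1$1 = 0 \<and> (\<exists>a. Y + a *\<^sub>C mat 1 \<in> B)}"
  have shift: "\<exists>a. Y + a *\<^sub>C mat 1 \<in> B" if "Y \<in> U" for Y
    using that by (simp add: U_def)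
  have "\<exists>Z\<in>{Z1, Z2, Z3, Z4}. M_equivalent B Z"
  proof (rule zero_first_row_cases[of U])
    show "complement_of_M U"
      unfolding U_def using B plane by (rule complement_zero_first_row)
    show "X$1$1 = 0 \<and> X$1$2 = 0 \<and> X$1$3 = 0" if "X \<in> U" for X
      using that unfolding U_def by (rule complement_zero_first_row(2)[OF B plane])
  next
    fix \<alpha> \<gamma>
    assume U: "e 2 1 \<in> U" "e 3 1 \<in> U" "e 2 2 + e 3 3 \<in> U" "e 3 2 + \<alpha> *\<^sub>C e 2 2 + \<gamma> *\<^sub>C e 2 3 \<in> U"
    have "e 2 1 ** e 2 1 = 0" "e 3 1 ** e 3 1 = 0"
      by (simp_all add: mat3_eq_iff entries)
    then have "e 2 1 \<in> B" "e 3 1 \<in> B"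
      using shift[OF U(1)] shift[OF U(2)] square_zero_in_complement[OF B] by blast+
    then show ?thesis
      using shift[OF U(3)] shift[OF U(4)] complement_classification_rank_two[OF B] by metis
  next
    fix \<alpha> c
    assume U: "e 3 3 + \<alpha> *\<^sub>C e 2 3 \<in> U" "e 3 2 + \<alpha> *\<^sub>C e 2 2 \<in> U"
      "e 3 1 + \<alpha> *\<^sub>C e 2 1 \<in> U" "e 2 1 + c *\<^sub>C (e 2 2 - \<alpha> *\<^sub>C e 2 3) \<in> U"
    \<comment> \<open>This conjugation removes \<open>\<alpha>\<close>.\<close>
    define g h where "g = mat 1 - \<alpha> *\<^sub>C e 2 3" and "h = mat 1 + \<alpha> *\<^sub>C e 2 3"
    define C where "C = {Z. h ** Z ** g \<in> B}"
    have BC: "M_equivalent B C"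
      unfolding C_def by (rule M_equivalent_conjugate)
        (simp_all add: g_def h_def upper_triangular_def mat3_eq_iff entries)
    then have C: "complement_of_M C"
      using B by (rule complement_of_M_equivalent)
    have shiftC: "\<exists>a. N + a *\<^sub>C mat 1 \<in> C" if N: "h ** N ** g \<in> U" for N
    proof -
      obtain a where "h ** N ** g + a *\<^sub>C mat 1 \<in> B"
        using shift[OF N] by blast
      also have "h ** N ** g + a *\<^sub>C mat 1 = h ** (N + a *\<^sub>C mat 1) ** g"
        by (simp add: g_def h_def mat3_eq_iff entries algebra_simps)
      finally show ?thesis
        by (auto simp: C_def)
    qed
    have "h ** e 3 3 ** g = e 3 3 + \<alpha> *\<^sub>C e 2 3" "h ** e 3 1 ** g = e 3 1 + \<alpha> *\<^sub>C e 2 1"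
      "h ** (e 2 1 + c *\<^sub>C e 2 2) ** g = e 2 1 + c *\<^sub>C (e 2 2 - \<alpha> *\<^sub>C e 2 3)"
      "h ** e 3 2 ** g = (e 3 2 + \<alpha> *\<^sub>C e 2 2) - \<alpha> *\<^sub>C (e 3 3 + \<alpha> *\<^sub>C e 2 3)"
      by (simp_all add: g_def h_def mat3_eq_iff entries)
    moreover have "subalgebra U"
      using complement_zero_first_row(1)[OF B plane] by (simp add: U_def complement_of_M_def)
    ultimately have "h ** e 3 3 ** g \<in> U" "h ** e 3 1 ** g \<in> U"
      "h ** (e 2 1 + c *\<^sub>C e 2 2) ** g \<in> U" "h ** e 3 2 ** g \<in> U"
      using U by (simp_all add: subalgebraD)
    note shifts = this[THEN shiftC]
    have "e 3 1 ** e 3 1 = 0" "e 3 2 ** e 3 2 = 0"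
      by (simp_all add: mat3_eq_iff entries)
    then have "e 3 1 \<in> C" "e 3 2 \<in> C"
      using shifts(2,4) square_zero_in_complement[OF C] by blast+
    then obtain Z where "Z \<in> {Z1, Z2, Z3, Z4}" "M_equivalent C Z"
      using shifts(1,3) complement_classification_rank_one[OF C] by metis
    then show ?thesis
      using M_equivalent_trans[OF BC] by blast
  qed
  then show ?thesis
    using that M_equivalent_trans[OF AB] by blast
qed

theorem theorem8:
  fixes A B :: "cmat3 set"
  assumes "subalgebra A" and "subalgebra B"
    and "direct_sum_decomposition A B"
    and "cmat.dim A = 4" and "cmat.dim B = 5"
    and "\<exists>\<psi>. (automorphism \<psi> \<or> antiautomorphism \<psi>) \<and> B = \<psi> ` M"
  shows "\<exists>\<phi>. (automorphism \<phi> \<or> antiautomorphism \<phi>) \<and> \<phi> ` B = M \<and>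
           (\<phi> ` A = Z1 \<or> \<phi> ` A = Z2 \<or> \<phi> ` A = Z3 \<or> \<phi> ` A = Z4)"
proof -
  obtain \<psi> where \<psi>: "symmetry \<psi>" and B: "B = \<psi> ` M"
    using assms(6) unfolding symmetry_def by blast
  have "inj \<psi>"
    using \<psi> by (simp add: symmetry_iff bij_is_inj)
  then have BM: "inv \<psi> ` B = M"
    by (simp add: B image_inv_f_f)
  have inv: "symmetry (inv \<psi>)"
    using \<psi> by (rule symmetry_inv)
  have "complement_of_M (inv \<psi> ` A)"
    unfolding complement_of_M_def
    using subalgebra_image[OF inv assms(1)] direct_sum_decomposition_image[OF inv assms(3)]
    by (simp add: BM)
  then obtain Z where Z: "Z \<in> {Z1, Z2, Z3, Z4}" "M_equivalent (inv \<psi> ` A) Z"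
    by (rule complement_classification)
  then obtain \<phi> where \<phi>: "symmetry \<phi>" "\<phi> ` M = M" "\<phi> ` (inv \<psi> ` A) = Z"
    unfolding M_equivalent_def by blast
  have "symmetry (\<phi> \<circ> inv \<psi>)"
    using \<phi>(1) inv by (rule symmetry_comp)
  moreover have "(\<phi> \<circ> inv \<psi>) ` B = M" "(\<phi> \<circ> inv \<psi>) ` A = Z"
    by (simp_all only: image_comp[symmetric] BM \<phi>)
  ultimately show ?thesis
    using Z(1) unfolding symmetry_def by blast
qed

end
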